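(* Let $q=2^t$ with $t$ even, and let $n\geq 4$ be even. Then there exists a complete cap in the affine space $AG(n,q)$ of size $2\sqrt{q}^{\,n-1}$.
   Context: A cap in an affine or projective space over a finite field is a set of points no three of which are collinear. A cap is complete if it is maximal with respect to set-theoretic inclusion among caps. *)

theory Defs
  imports "HOL-Analysis.Cartesian_Space"
begin

text \<open>
  The points of the affine space \<open>AG(n,q)\<close> are the vectors of type \<open>'a ^ 'n\<close>, where
  \<open>'a\<close> is a finite field with \<open>q\<close> elements and \<open>CARD('n) = n\<close>. The library's
  \<open>collinear\<close> is restricted to real vector spaces, so lines are defined here.
\<close>

definition affine_line :: "('a::field ^ 'n) set \<Rightarrow> bool" where
  "affine_line L \<longleftrightarrow> (\<exists>a d. d \<noteq> 0 \<and> L = range (\<lambda>c. a + c *s d))"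

definition collinear_points :: "('a::field ^ 'n) set \<Rightarrow> bool" where
  "collinear_points S \<longleftrightarrow> (\<exists>L. affine_line L \<and> S \<subseteq> L)"

definition affine_cap :: "('a::field ^ 'n) set \<Rightarrow> bool" where
  "affine_cap C \<longleftrightarrow>
     (\<forall>x\<in>C. \<forall>y\<in>C. \<forall>z\<in>C.
        x \<noteq> y \<and> x \<noteq> z \<and> y \<noteq> z \<longrightarrow> \<not> collinear_points {x, y, z})"

definition complete_affine_cap :: "('a::field ^ 'n) set \<Rightarrow> bool" where
  "complete_affine_cap C \<longleftrightarrow>
     affine_cap C \<and> (\<forall>D. affine_cap D \<and> C \<subseteq> D \<longrightarrow> D = C)"

end

theory Submission
  imports Defs "HOL-Computational_Algebra.Polynomial"
begin

text \<open>
  In characteristic 2 an additive subgroup \<open>A\<close> of a vector space over the field \<open>F\<close> with \<open>q\<close>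
  elements is a cap as soon as no two distinct nonzero elements of \<open>A\<close> are proportional, i.e.
  \<open>A\<close> is a scattered \<open>F\<^sub>2\<close>-linear set. If moreover \<open>A\<close> lies in a hyperplane through the origin
  and has \<open>q ^ ((n - 1) / 2)\<close> elements, then \<open>A + l A\<close> is the whole hyperplane for every scalar
  \<open>l \<noteq> 0, 1\<close> by counting, and the union of \<open>A\<close> with a translate of it outside the hyperplane is a
  complete cap.

  Such an \<open>A\<close> is a direct product of planar blocks \<open>{(x, x\<^sup>2)}\<close> with one three-dimensional block
  \<open>{f v + w v | v \<in> K\<^sup>3}\<close>, where \<open>K\<close> is the subfield of index 2, \<open>w \<notin> K\<close>, and \<open>f\<close> is additive with
  \<open>f (a v) = a\<^sup>2 f v\<close>. This block is scattered if \<open>f\<close> has no invariant proper subspace. For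
  \<open>f (x, y, z) = (c z\<^sup>2, x\<^sup>2 + z\<^sup>2, y\<^sup>2)\<close> invariant planes correspond to roots of \<open>b ^ 7 + b + c\<close>
  in \<open>K\<close>, and invariant lines to roots of an adjoint polynomial, which exist only if the former do.
  Since \<open>b \<mapsto> b ^ 7 + b\<close> identifies 0 and 1, it is not surjective on \<open>K\<close>, so a suitable \<open>c\<close> exists.
\<close>

section \<open>Arithmetic over a subfield of a finite field of characteristic 2\<close>

locale char2_subfield =
  fixes K :: "'a::{field,finite} set"
  assumes one_plus_one: "(1::'a) + 1 = 0"
    and zero_mem: "0 \<in> K" and one_mem: "1 \<in> K"
    and add_mem: "x \<in> K \<Longrightarrow> y \<in> K \<Longrightarrow> x + y \<in> K"
    and mult_mem: "x \<in> K \<Longrightarrow> y \<in> K \<Longrightarrow> x * y \<in> K"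
    and inverse_mem: "x \<in> K \<Longrightarrow> inverse x \<in> K"
begin

lemma power_mem: "x \<in> K \<Longrightarrow> x ^ k \<in> K"
  by (induction k) (auto intro: one_mem mult_mem)

lemma divide_mem: "x \<in> K \<Longrightarrow> y \<in> K \<Longrightarrow> x / y \<in> K"
  by (simp add: divide_inverse mult_mem inverse_mem)

lemmas mem = zero_mem one_mem add_mem mult_mem inverse_mem power_mem divide_mem

lemma numeral_even: "numeral (num.Bit0 k) = (0::'a)"
  using one_plus_one by (metis mult_2 mult_zero_left numeral_Bit0 numeral_One mult_1 distrib_right)

lemma numeral_odd: "numeral (num.Bit1 k) = (1::'a)"
  using numeral_even[of k] by (simp only: numeral_Bit0 numeral_Bit1 add_0)

lemma add_self: "x + x = (0::'a)"
  using numeral_even[of num.One] by (metis mult_2 mult_zero_left)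

lemma add_self_left: "x + (x + y) = (y::'a)"
  by (simp add: add_self flip: add.assoc)

lemma uminus_eq: "- x = (x::'a)"
  using add_self by (simp add: minus_unique)

lemma square_add: "(x + y) ^ 2 = x ^ 2 + (y::'a) ^ 2"
  by (simp add: power2_sum numeral_even)

lemma power4_add: "(x + y) ^ 4 = x ^ 4 + (y::'a) ^ 4"
  using square_add[of "x ^ 2" "y ^ 2"] by (simp flip: square_add power_mult)

lemma power8_add: "(x + y) ^ 8 = x ^ 8 + (y::'a) ^ 8"
  using square_add[of "x ^ 4" "y ^ 4"] by (simp flip: power4_add power_mult)

lemmas frobenius = square_add power4_add power8_add power_mult_distrib

lemmas normalize = numeral_even numeral_odd add_self add_self_left eval_nat_numeral
  distrib_left distrib_right add_ac mult_ac

lemma add_eq_0_iff_eq: "x + y = 0 \<longleftrightarrow> x = (y::'a)"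
  using eq_neg_iff_add_eq_0[of x y] by (simp add: uminus_eq)

section \<open>Scalars missed by polynomial maps on the subfield\<close>

lemma not_surj_on_if_collision:
  assumes "\<And>x. x \<in> K \<Longrightarrow> f x \<in> K" and "f 0 = f 1"
  shows "\<exists>k\<in>K. \<forall>x\<in>K. f x \<noteq> k"
proof (rule ccontr)
  assume "\<not> ?thesis"
  then have "f ` K = K"
    using assms(1) by (auto simp: image_iff)
  then have "inj_on f K"
    by (intro eq_card_imp_inj_on) simp_all
  then show False
    using assms(2) zero_mem one_mem by (auto dest: inj_onD)
qed

lemma ex_septic_nonvalue: "\<exists>c\<in>K. \<forall>x\<in>K. x ^ 7 + x \<noteq> c"
  by (rule not_surj_on_if_collision) (auto intro: mem simp: numeral_even)

lemma ex_Artin_Schreier_nonvalue: "\<exists>k\<in>K. \<forall>x\<in>K. x ^ 2 + x \<noteq> k"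
  by (rule not_surj_on_if_collision) (auto intro: mem simp: numeral_even)

text \<open>The choice of \<open>c\<close> gives the additive map
  \<open>L b = b ^ 8 + b ^ 2 + c * b\<close> trivial kernel, hence bijectivity, on \<open>K\<close>.
  A nonzero root \<open>w\<close> would put \<open>w ^ 2 * L b\<close> into the image of
  \<open>x ^ 2 + x\<close> for all \<open>b\<close> in \<open>K\<close>, yet \<open>L b\<close>
  takes every value in \<open>K\<close>.\<close>

lemma no_adjoint_root:
  assumes c: "c \<in> K" "\<And>x. x \<in> K \<Longrightarrow> x ^ 7 + x \<noteq> c"
    and w: "w \<in> K" "c ^ 4 * w ^ 8 + w ^ 4 + w = 0"
  shows "w = 0"
proof (rule ccontr)
  assume "w \<noteq> 0"
  define L where "L b = b ^ 8 + b ^ 2 + c * b" for b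
  have L_mem: "L b \<in> K" if "b \<in> K" for b
    using that c by (auto simp: L_def intro!: mem)
  have L_add: "L (x + y) = L x + L y" for x y
    unfolding L_def by (simp add: frobenius distrib_left ac_simps)
  have L_0: "b = 0" if "b \<in> K" "L b = 0" for b
  proof (rule ccontr)
    assume "b \<noteq> 0"
    have "b * (b ^ 7 + b + c) = 0"
      using that(2) unfolding L_def by algebra
    then have "b ^ 7 + b + c = 0" using \<open>b \<noteq> 0\<close> by simp
    then show False using c(2)[OF that(1)] by (simp add: add_eq_0_iff_eq)
  qed
  have "inj_on L K"
  proof (rule inj_onI)
    fix x y assume "x \<in> K" "y \<in> K" "L x = L y"
    then have "L (x + y) = 0" by (simp add: L_add add_self)
    then show "x = y" using L_0 \<open>x \<in> K\<close> \<open>y \<in> K\<close> add_mem add_eq_0_iff_eq by blast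
  qed
  then have L_surj: "L ` K = K"
    using L_mem by (intro endo_inj_surj) auto
  obtain k where k: "k \<in> K" "\<And>x. x \<in> K \<Longrightarrow> x ^ 2 + x \<noteq> k"
    using ex_Artin_Schreier_nonvalue by blast
  have "k / w ^ 2 \<in> L ` K" unfolding L_surj using k w by (intro mem)
  then obtain b where b: "b \<in> K" "L b = k / w ^ 2" by force
  \<comment> \<open>\<open>X\<close> and \<open>Y\<close> are the lower terms of
    \<open>w ^ 2 * L b\<close>. In \<open>T ^ 2 + T\<close> the sum \<open>T\<close> telescopes,
    leaving \<open>X ^ 8 + X\<close> and \<open>Y ^ 4 + Y\<close>.\<close>
  define X where "X = w ^ 2 * c * b"
  define Y where "Y = w ^ 2 * b ^ 2"
  define T where "T = X ^ 4 + X ^ 2 + X + Y ^ 2 + Y"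
  have "T \<in> K" unfolding T_def X_def Y_def using w b c by (auto intro!: mem)
  \<comment> \<open>Modulo the Artin-Schreier image every element is congruent to its square, which turns
    \<open>w\<^sup>2 * L b\<close> into \<open>b ^ 8\<close> times the square of the equation for \<open>w\<close>.\<close>
  have "T ^ 2 + T = X ^ 8 + X + Y ^ 4 + Y"
    by (simp add: T_def square_add add_self_left add_ac flip: power_mult)
  also have "\<dots> = w ^ 2 * L b + b ^ 8 * (c ^ 8 * w ^ 16 + w ^ 8 + w ^ 2)"
  proof -
    have "w ^ 2 * L b = w ^ 2 * b ^ 8 + Y + X"
      unfolding L_def X_def Y_def by algebra
    moreover have "b ^ 8 * (c ^ 8 * w ^ 16 + w ^ 8 + w ^ 2) = X ^ 8 + Y ^ 4 + w ^ 2 * b ^ 8"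
      unfolding X_def Y_def by algebra
    ultimately show ?thesis by (simp add: add_self_left numeral_even add_ac)
  qed
  also have "c ^ 8 * w ^ 16 + w ^ 8 + w ^ 2 = (c ^ 4 * w ^ 8 + w ^ 4 + w) ^ 2"
    by (simp add: frobenius flip: power_mult)
  also have "w ^ 2 * L b + b ^ 8 * (c ^ 4 * w ^ 8 + w ^ 4 + w) ^ 2 = k" using b \<open>w \<noteq> 0\<close> w(2) by simp
  finally show False using k(2) \<open>T \<in> K\<close> by blast
qed

section \<open>The three-dimensional semilinear block\<close>

text \<open>A vector orthogonal to two others is proportional to their cross product, whose signs
  disappear in characteristic 2. The conclusions are the vanishing minors.\<close>

lemma triple_product:
  fixes p1 p2 p3 x1 x2 x3 y1 y2 y3 :: 'a
  assumes "p1 * x1 + p2 * x2 + p3 * x3 = 0" and "p1 * y1 + p2 * y2 + p3 * y3 = 0"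
  shows "p1 * (x3 * y1 + x1 * y3) = p2 * (x2 * y3 + x3 * y2)"
    and "p1 * (x1 * y2 + x2 * y1) = p3 * (x2 * y3 + x3 * y2)"
    and "p2 * (x1 * y2 + x2 * y1) = p3 * (x3 * y1 + x1 * y3)"
proof -
  have "p1 * (x3 * y1 + x1 * y3) + p2 * (x2 * y3 + x3 * y2) =
      x3 * (p1 * y1 + p2 * y2 + p3 * y3) + y3 * (p1 * x1 + p2 * x2 + p3 * x3)"
    by (simp add: normalize)
  then show "p1 * (x3 * y1 + x1 * y3) = p2 * (x2 * y3 + x3 * y2)"
    unfolding assms by (simp add: add_eq_0_iff_eq)
  have "p1 * (x1 * y2 + x2 * y1) + p3 * (x2 * y3 + x3 * y2) =
      x2 * (p1 * y1 + p2 * y2 + p3 * y3) + y2 * (p1 * x1 + p2 * x2 + p3 * x3)"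
    by (simp add: normalize)
  then show "p1 * (x1 * y2 + x2 * y1) = p3 * (x2 * y3 + x3 * y2)"
    unfolding assms by (simp add: add_eq_0_iff_eq)
  have "p2 * (x1 * y2 + x2 * y1) + p3 * (x3 * y1 + x1 * y3) =
      x1 * (p1 * y1 + p2 * y2 + p3 * y3) + y1 * (p1 * x1 + p2 * x2 + p3 * x3)"
    by (simp add: normalize)
  then show "p2 * (x1 * y2 + x2 * y1) = p3 * (x3 * y1 + x1 * y3)"
    unfolding assms by (simp add: add_eq_0_iff_eq)
qed

text \<open>For \<open>f (x, y, z) = (c z^2, x^2 + z^2, y^2)\<close> the assumption
  \<open>dep\<close> says that \<open>f (f v)\<close> is a combination of \<open>v\<close> and
  \<open>f v\<close>, so these would span an invariant subspace. A plane yields a root of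
  \<open>b ^ 7 + b + c\<close>, a line a root of the adjoint equation.\<close>

lemma semilinear_cyclic:
  assumes c: "c \<in> K" "\<And>x. x \<in> K \<Longrightarrow> x ^ 7 + x \<noteq> c"
    and K: "x \<in> K" "y \<in> K" "z \<in> K"
    and dep: "c * y ^ 4 = p * x + r * (c * z ^ 2)"
      "c ^ 2 * z ^ 4 + y ^ 4 = p * y + r * (x ^ 2 + z ^ 2)"
      "x ^ 4 + z ^ 4 = p * z + r * y ^ 2"
  shows "x = 0 \<and> y = 0 \<and> z = 0"
proof (rule ccontr)
  assume nz: "\<not> ?thesis"
  have "c \<noteq> 0" using c(2)[OF zero_mem] by auto
  define u where "u = y * y ^ 2 + z * (x ^ 2 + z ^ 2)"
  define v where "v = z * (c * z ^ 2) + x * y ^ 2"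
  define w where "w = x * (x ^ 2 + z ^ 2) + y * (c * z ^ 2)"
  have mem_uv: "u \<in> K" "v \<in> K" unfolding u_def v_def using c K by (auto intro!: mem)
  \<comment> \<open>The cross product \<open>(u, v, w)\<close> annihilates the vector and its first two images.\<close>
  have o1: "v * x ^ 2 + w * y ^ 2 + (c * u + v) * z ^ 2 = 0"
    unfolding u_def v_def w_def by (simp add: normalize)
  have "u * x + v * y + w * z = 0"
    unfolding u_def v_def w_def by (simp add: normalize)
  moreover have "u * (c * z ^ 2) + v * (x ^ 2 + z ^ 2) + w * y ^ 2 = 0"
    unfolding u_def v_def w_def by (simp add: normalize)
  ultimately have "u * (c * y ^ 4) + v * (c ^ 2 * z ^ 4 + y ^ 4) + w * (x ^ 4 + z ^ 4) = 0"
    unfolding dep by algebra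
  then have o2: "v * (c * z ^ 2) ^ 2 + w * (x ^ 2 + z ^ 2) ^ 2 + (c * u + v) * (y ^ 2) ^ 2 = 0"
    by (simp only: frobenius flip: power_mult) (simp add: normalize)
  have squares: "u ^ 2 = y ^ 2 * (y ^ 2) ^ 2 + z ^ 2 * (x ^ 2 + z ^ 2) ^ 2"
    "v ^ 2 = z ^ 2 * (c * z ^ 2) ^ 2 + x ^ 2 * (y ^ 2) ^ 2"
    "w ^ 2 = x ^ 2 * (x ^ 2 + z ^ 2) ^ 2 + y ^ 2 * (c * z ^ 2) ^ 2"
    unfolding u_def v_def w_def by (simp_all add: frobenius)
  \<comment> \<open>By \<open>o1\<close> and \<open>o2\<close>, \<open>(v, w, c * u + v)\<close> is
    orthogonal to the coordinatewise squares of the vector and of its image. The cross product of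
    these squares is \<open>(u ^ 2, v ^ 2, w ^ 2)\<close>.\<close>
  have par: "v * v ^ 2 = w * u ^ 2" "v * w ^ 2 = (c * u + v) * u ^ 2"
      "w * w ^ 2 = (c * u + v) * v ^ 2"
    unfolding squares using triple_product[OF o1 o2] by simp_all
  show False
  proof (cases "u = 0")
    case False
    \<comment> \<open>Invariant plane: its normal is proportional to \<open>(1, k, k ^ 3)\<close>,
      and the remaining relation makes \<open>k\<close> a forbidden root.\<close>
    have "v / u \<in> K" using mem_uv by (auto intro: mem)
    define k where "k = v / u"
    have v: "v = k * u" using False by (simp add: k_def)
    have "u ^ 2 * w = u ^ 2 * (k ^ 3 * u)"
      using par(1) unfolding v by algebra
    then have "w = k ^ 3 * u" using False by simp
    then have "u ^ 3 * k ^ 7 = u ^ 3 * (c + k)"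
      using par(2) unfolding v by algebra
    then have "(v / u) ^ 7 = c + v / u"
      using False by (simp add: k_def)
    then have "(v / u) ^ 7 + v / u = c"
      by (simp add: add.assoc add_self)
    then show False using c(2) \<open>v / u \<in> K\<close> by blast
  next
    case True
    then have "v = 0" using par(1) by simp
    then have "w = 0" using par(3) True by simp
    have e: "y ^ 3 = z * (x ^ 2 + z ^ 2)" "c * z ^ 3 = x * y ^ 2"
        "x * (x ^ 2 + z ^ 2) = y * (c * z ^ 2)"
      using True \<open>v = 0\<close> \<open>w = 0\<close> unfolding u_def v_def w_def add_eq_0_iff_eq
      by (simp_all add: eval_nat_numeral mult_ac)
    have "z \<noteq> 0"
    proof
      assume "z = 0"
      then have "y = 0" using e(1) by simp
      then show False using e(3) \<open>z = 0\<close> nz by simp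
    qed
    then have "y \<noteq> 0" using e(2) \<open>c \<noteq> 0\<close> by auto
    \<comment> \<open>Invariant line: eliminating \<open>x\<close> from \<open>e\<close> gives an
      equation for \<open>z / y\<close>. Multiplied by \<open>z / y\<close> and squared, it becomes
      the adjoint equation for \<open>Z\<close>.\<close>
    define Z where "Z = z ^ 2 / y ^ 2"
    have "Z \<in> K" unfolding Z_def using K by (auto intro: mem)
    have Z: "Z * y ^ 2 = z ^ 2" using \<open>y \<noteq> 0\<close> by (simp add: Z_def)
    have "y ^ 7 = z * (c ^ 2 * z ^ 6 + z ^ 2 * y ^ 4)"
      using e(1,2) by algebra
    then have "y ^ 14 = z ^ 2 * (c ^ 2 * z ^ 6 + z ^ 2 * y ^ 4) ^ 2"
      by algebra
    also have "\<dots> = z ^ 2 * (c ^ 4 * z ^ 12 + z ^ 4 * y ^ 8)"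
      by (simp add: frobenius flip: power_mult)
    finally have "z ^ 2 * (c ^ 4 * z ^ 12 + z ^ 4 * y ^ 8) + y ^ 14 = 0"
      by (simp add: add_self)
    moreover have "y ^ 16 * (c ^ 4 * Z ^ 8 + Z ^ 4 + Z) =
       (z ^ 2 * (c ^ 4 * z ^ 12 + z ^ 4 * y ^ 8) + y ^ 14) * z ^ 2"
      using Z by algebra
    ultimately have "c ^ 4 * Z ^ 8 + Z ^ 4 + Z = 0" using \<open>y \<noteq> 0\<close> by simp
    then have "Z = 0" using no_adjoint_root[OF c \<open>Z \<in> K\<close>] by blast
    then show False using \<open>y \<noteq> 0\<close> \<open>z \<noteq> 0\<close> unfolding Z_def by simp
  qed
qed

lemma basis_unique:
  assumes "w \<notin> K" and "a \<in> K" "b \<in> K" "a' \<in> K" "b' \<in> K"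
    and "a + b * w = a' + b' * w"
  shows "a = a' \<and> b = b'"
proof -
  have "b = b'"
  proof (rule ccontr)
    assume "b \<noteq> b'"
    then have "b + b' \<noteq> 0" by (simp add: add_eq_0_iff_eq)
    have "(b + b') * w = a + a' + ((a + b * w) + (a' + b' * w))"
      by (simp add: distrib_right add_ac add_self add_self_left)
    also have "\<dots> = a + a'" by (simp add: assms(6) add_self)
    finally have "w = (a + a') / (b + b')" using \<open>b + b' \<noteq> 0\<close> by (simp add: field_simps)
    then show False using assms(1-5) by (auto intro!: divide_mem add_mem)
  qed
  then show ?thesis using assms(6) by simp
qed

text \<open>With \<open>l = a + b * w\<close>, comparing coefficients of \<open>1\<close> and
  \<open>w\<close> in \<open>l (f v + w v) = f v' + w v'\<close> expresses both \<open>v'\<close>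
  and \<open>f v'\<close> through \<open>v\<close> and \<open>f v\<close>. Applying \<open>f\<close>
  to \<open>v'\<close> then contradicts \<open>semilinear_cyclic\<close> unless
  \<open>b = 0\<close>.\<close>

lemma scattered_triple:
  assumes c: "c \<in> K" "\<And>x. x \<in> K \<Longrightarrow> x ^ 7 + x \<noteq> c"
    and w: "w \<notin> K" and span: "\<And>y. \<exists>a\<in>K. \<exists>b\<in>K. y = a + b * w"
    and K: "x \<in> K" "y \<in> K" "z \<in> K" "x' \<in> K" "y' \<in> K" "z' \<in> K"
    and nz: "\<not> (x = 0 \<and> y = 0 \<and> z = 0)"
    and eqs: "l * (c * z ^ 2 + x * w) = c * z' ^ 2 + x' * w"
      "l * (x ^ 2 + z ^ 2 + y * w) = x' ^ 2 + z' ^ 2 + y' * w"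
      "l * (y ^ 2 + z * w) = y' ^ 2 + z' * w"
  shows "l = 0 \<or> l = 1"
proof -
  obtain a b where ab: "a \<in> K" "b \<in> K" "l = a + b * w" using span by blast
  obtain d t where dt: "d \<in> K" "t \<in> K" "w ^ 2 = d + t * w" using span by blast
  \<comment> \<open>Here \<open>l * w = b * d + A * w\<close>.\<close>
  define A where "A = a + b * t"
  have "A \<in> K" using ab dt by (auto simp: A_def intro!: mem)
  have split: "a * f + b * d * g = f' \<and> A * g + b * f = g'"
    if "f \<in> K" "g \<in> K" "f' \<in> K" "g' \<in> K" "l * (f + g * w) = f' + g' * w" for f g f' g'
  proof -
    have "a * f + b * d * g + (A * g + b * f) * w = l * (f + g * w)"
      unfolding ab(3) A_def using dt(3) by algebra
    with that ab dt w \<open>A \<in> K\<close> show ?thesis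
      by (intro basis_unique[of w]) (auto intro!: mem)
  qed
  have 1: "a * (c * z ^ 2) + b * d * x = c * z' ^ 2" "x' = A * x + b * (c * z ^ 2)"
    using split[OF _ _ _ _ eqs(1)] K c by (auto intro!: mem)
  have 2: "a * (x ^ 2 + z ^ 2) + b * d * y = x' ^ 2 + z' ^ 2" "y' = A * y + b * (x ^ 2 + z ^ 2)"
    using split[OF _ _ _ _ eqs(2)] K c by (auto intro!: mem)
  have 3: "a * y ^ 2 + b * d * z = y' ^ 2" "z' = A * z + b * y ^ 2"
    using split[OF _ _ _ _ eqs(3)] K c by (auto intro!: mem)
  have z'2: "z' ^ 2 = A ^ 2 * z ^ 2 + b ^ 2 * y ^ 4"
    unfolding 3(2) by (simp add: frobenius flip: power_mult)
  have x'2: "x' ^ 2 = A ^ 2 * x ^ 2 + b ^ 2 * (c ^ 2 * z ^ 4)"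
    unfolding 1(2) by (simp add: frobenius flip: power_mult)
  have y'2: "y' ^ 2 = A ^ 2 * y ^ 2 + b ^ 2 * (x ^ 4 + z ^ 4)"
    unfolding 2(2) by (simp add: frobenius flip: power_mult)
  show ?thesis
  proof (cases "b = 0")
    case False
    \<comment> \<open>Equating the two expressions for \<open>f v'\<close> and dividing by
      \<open>b ^ 2\<close> gives \<open>f (f v) = p v + r f v\<close> with these scalars.\<close>
    define p where "p = d / b"
    define r where "r = (a + A ^ 2) / b ^ 2"
    have p: "b ^ 2 * p = b * d" and r: "b ^ 2 * r = a + A ^ 2"
      using False by (simp_all add: p_def r_def power2_eq_square)
    have solve: "P = p * Q + r * R" if "a * R + b * d * Q = A ^ 2 * R + b ^ 2 * P" for P Q R
    proof -
      have "b ^ 2 * P = a * R + b * d * Q + A ^ 2 * R"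
        unfolding that by (simp add: add_self_left add_ac)
      also have "\<dots> = b ^ 2 * (p * Q + r * R)"
        using p r by algebra
      finally show ?thesis using False by simp
    qed
    have "c * y ^ 4 = p * x + r * (c * z ^ 2)"
      by (rule solve, unfold 1(1) z'2) (simp add: algebra_simps)
    moreover have "c ^ 2 * z ^ 4 + y ^ 4 = p * y + r * (x ^ 2 + z ^ 2)"
      by (rule solve, unfold 2(1) z'2 x'2) (simp add: algebra_simps)
    moreover have "x ^ 4 + z ^ 4 = p * z + r * y ^ 2"
      by (rule solve, unfold 3(1) y'2) (rule refl)
    ultimately show ?thesis
      using semilinear_cyclic[OF c K(1-3)] nz by blast
  next
    case True
    have "c \<noteq> 0" using c(2)[OF zero_mem] by auto
    have "a = 0 \<or> a = 1"
    proof (rule ccontr)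
      assume a: "\<not> ?thesis"
      \<comment> \<open>For \<open>b = 0\<close> the two expressions for \<open>f v'\<close> are
        \<open>a f v\<close> and \<open>a ^ 2 f v\<close>, while \<open>f\<close> has trivial
        kernel.\<close>
      have *: "R = 0" if "a * R = a ^ 2 * R" for R
        using that a by (simp add: power2_eq_square)
      have "c * z ^ 2 = 0" using 1(1) z'2 True by (intro *) (simp add: A_def)
      then have "z = 0" using \<open>c \<noteq> 0\<close> by simp
      moreover have "x ^ 2 + z ^ 2 = 0"
        using 2(1) x'2 z'2 True by (intro *) (simp add: A_def distrib_left)
      moreover have "y ^ 2 = 0" using 3(1) y'2 True by (intro *) (simp add: A_def)
      ultimately show False using nz by simp
    qed
    then show ?thesis using ab(3) True by simp
  qed
qed

end

section \<open>Fields of order a power of 2 and the subfield of index 2\<close>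

text \<open>Translation by 1 permutes the field, so comparing the sums over all elements shows that
  the order of the field is zero in it.\<close>

lemma finite_field_char2:
  assumes "CARD('a::{field,finite}) = 2 ^ t"
  shows "(1::'a) + 1 = 0"
proof -
  have "(\<Sum>y\<in>UNIV. y) = (\<Sum>y\<in>UNIV. y + (1::'a))"
    by (rule sum.reindex_bij_witness[of _ "\<lambda>y. y + 1" "\<lambda>y. y - 1"]) auto
  then have "of_nat CARD('a) = (0::'a)" by (simp add: sum.distrib)
  then show ?thesis using assms by simp
qed

lemma finite_field_power_card:
  fixes x :: "'a::{field,finite}"
  shows "x ^ CARD('a) = x"
proof (cases "x = 0")
  case False
  have "(\<Prod>y\<in>UNIV - {0}. y) = (\<Prod>y\<in>UNIV - {0}. x * y)"
    using False
    by (intro prod.reindex_bij_witness[of _ "\<lambda>y. x * y" "\<lambda>y. y / x"]) auto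
  also have "\<dots> = x ^ (CARD('a) - 1) * (\<Prod>y\<in>UNIV - {0}. y)"
    by (simp add: prod.distrib)
  finally have "x ^ (CARD('a) - 1) = 1" by simp
  then have "x ^ Suc (CARD('a) - 1) = x" by (simp only: power_Suc mult_1_right)
  moreover have "Suc (CARD('a) - 1) = CARD('a)" by simp
  ultimately show ?thesis by metis
qed (simp add: card_gt_0_iff)

lemma char2_power_add:
  fixes x y :: "'a::comm_ring_1"
  assumes "(1::'a) + 1 = 0"
  shows "(x + y) ^ 2 ^ h = x ^ 2 ^ h + y ^ 2 ^ h"
proof (induction h)
  case (Suc h)
  have 2: "(2::'a) = 0" using assms by simp
  have "(x + y) ^ 2 ^ Suc h = ((x + y) ^ 2 ^ h) ^ 2"
    by (simp add: mult.commute flip: power_mult)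
  also have "\<dots> = (x ^ 2 ^ h) ^ 2 + (y ^ 2 ^ h) ^ 2"
    by (simp add: Suc.IH power2_sum 2)
  finally show ?case by (simp add: mult.commute flip: power_mult)
qed simp

lemma char2_subfield_fixed:
  assumes "(1::'a::{field,finite}) + 1 = 0"
  shows "char2_subfield {x::'a. x ^ 2 ^ h = x}"
  using assms
  by unfold_locales (auto simp: char2_power_add power_mult_distrib power_inverse zero_power)

text \<open>The upper bound counts roots of \<open>X ^ s - X\<close>. The lower bound uses the
  relative trace \<open>x ^ s + x\<close> into the fixed field: its fibres have at most
  \<open>card K\<close> elements, so \<open>s * s \<le> card K * card K\<close>.\<close>

lemma card_fixed:
  fixes h :: nat
  assumes card: "CARD('a::{field,finite}) = 2 ^ (2 * h)" and "h > 0"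
  shows "card {x::'a. x ^ 2 ^ h = x} = 2 ^ h"
proof -
  define s :: nat where "s = 2 ^ h"
  have "s > 1" using \<open>h > 0\<close> unfolding s_def by (intro one_less_power) simp_all
  define K where "K = {x::'a. x ^ s = x}"
  have two: "(1::'a) + 1 = 0" by (rule finite_field_char2[OF card])
  interpret char2_subfield K
    unfolding K_def s_def by (rule char2_subfield_fixed[OF two])
  have power_s_s: "(x ^ s) ^ s = x" for x :: 'a
    using finite_field_power_card[of x] card
    by (simp add: s_def power_mult power2_eq_square mult_2 flip: power_add power_mult)
  define p where "p = monom (1::'a) s - monom 1 1"
  have "coeff p s = 1" using \<open>s > 1\<close> by (simp add: p_def)
  then have "p \<noteq> 0" by auto
  have "degree p \<le> s" unfolding p_def using \<open>s > 1\<close>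
    by (intro degree_diff_le) (auto intro: order.trans[OF degree_monom_le])
  moreover have "K = {x. poly p x = 0}"
    by (auto simp: K_def p_def poly_monom)
  ultimately have le: "card K \<le> s"
    using card_poly_roots_bound[OF \<open>p \<noteq> 0\<close>] by simp
  \<comment> \<open>The fibres of \<open>x \<mapsto> x ^ s + x\<close>, which maps into \<open>K\<close>, are cosets of \<open>K\<close>.\<close>
  define g where "g x = x ^ s + x" for x :: 'a
  have g_add: "g (x + y) = g x + g y" for x y
    by (simp add: g_def s_def char2_power_add[OF two] add_ac)
  have "g x \<in> K" for x
    using power_s_s[of x] unfolding K_def g_def
    by (simp add: s_def char2_power_add[OF two] add.commute)
  then have "UNIV = (\<Union>k\<in>K. {x. g x = k})" by auto
  then have "CARD('a) \<le> (\<Sum>k\<in>K. card {x. g x = k})"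
    by (metis card_UN_le finite)
  also have "\<dots> \<le> (\<Sum>k\<in>K. card K)"
  proof (rule sum_mono)
    fix k
    show "card {x. g x = k} \<le> card K"
    proof (cases "\<exists>x0. g x0 = k")
      case True
      then obtain x0 where "g x0 = k" ..
      then have "g (x + x0) = 0" if "g x = k" for x
        using that by (simp add: g_add add_self)
      then have "x + x0 \<in> K" if "g x = k" for x
        using that by (simp add: g_def K_def add_eq_0_iff_eq)
      then show ?thesis by (intro card_inj_on_le[of "\<lambda>x. x + x0"]) auto
    qed simp
  qed
  finally have "s * s \<le> card K * card K"
    by (simp add: card s_def mult_2 power_add)
  then have "s \<le> card K"
    using mult_le_cancel1 by (metis linorder_not_le mult_strict_mono' le0)
  with le show ?thesis by (simp add: K_def s_def)
qed

section \<open>Scattered additive sets and complete caps\<close>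

text \<open>The alternative \<open>l = 0\<close> accounts for \<open>v = 0\<close>.\<close>

definition scattered :: "('a::field ^ 'n) set \<Rightarrow> bool" where
  "scattered A \<longleftrightarrow>
     (\<forall>u\<in>A. \<forall>v\<in>A. \<forall>l. u \<noteq> 0 \<and> v = l *s u \<longrightarrow> l = 0 \<or> l = 1)"

lemma collinear_points_iff:
  fixes x y z :: "'a::field ^ 'n"
  assumes "x \<noteq> y"
  shows "collinear_points {x, y, z} \<longleftrightarrow> (\<exists>l. z = x + l *s (y - x))"
proof
  assume "collinear_points {x, y, z}"
  then obtain a d where "x \<in> range (\<lambda>c. a + c *s d)" "y \<in> range (\<lambda>c. a + c *s d)"
      "z \<in> range (\<lambda>c. a + c *s d)"
    unfolding collinear_points_def affine_line_def by auto
  then obtain r s t where eqs: "x = a + r *s d" "y = a + s *s d" "z = a + t *s d"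
    by (elim rangeE)
  then have "s \<noteq> r" using assms by auto
  have "y - x = (s - r) *s d" "z - x = (t - r) *s d"
    by (simp_all add: eqs vector_sub_rdistrib)
  then have "z - x = ((t - r) / (s - r)) *s (y - x)"
    using \<open>s \<noteq> r\<close> by (simp add: vector_smult_assoc)
  then have "z = x + ((t - r) / (s - r)) *s (y - x)"
    by (metis add.commute diff_add_cancel)
  then show "\<exists>l. z = x + l *s (y - x)" ..
next
  assume "\<exists>l. z = x + l *s (y - x)"
  then obtain l where l: "z = x + l *s (y - x)" ..
  have "x = x + 0 *s (y - x)" "y = x + 1 *s (y - x)" by simp_all
  with l have "{x, y, z} \<subseteq> range (\<lambda>c. x + c *s (y - x))" by blast
  then show "collinear_points {x, y, z}"
    unfolding collinear_points_def affine_line_def using assms by (metis right_minus_eq)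
qed

lemma vec_char2:
  fixes x y :: "'a::field ^ 'n"
  assumes "(1::'a) + 1 = 0"
  shows "x - y = x + y" "x + x = 0"
proof -
  have "a + a = 0" for a :: 'a
    using assms by (metis distrib_left mult_1_right mult_zero_right)
  then have "a - b = a + b" for a b :: 'a
    by (metis add_diff_cancel_right' add.assoc add.right_neutral)
  then show "x - y = x + y" by (simp add: vec_eq_iff)
  show "x + x = 0" using \<open>\<And>a::'a. a + a = 0\<close> by (simp add: vec_eq_iff)
qed

text \<open>Translating one point of a collinear triple to the origin keeps the other two in
  \<open>A\<close> and makes them distinct, nonzero and proportional.\<close>

lemma affine_cap_if_scattered:
  fixes A :: "('a::field ^ 'n) set"
  assumes two: "(1::'a) + 1 = 0" and add: "\<And>u v. u \<in> A \<Longrightarrow> v \<in> A \<Longrightarrow> u + v \<in> A"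
    and "scattered A"
  shows "affine_cap A"
  unfolding affine_cap_def
proof (intro ballI impI notI)
  fix x y z assume A: "x \<in> A" "y \<in> A" "z \<in> A" and ne: "x \<noteq> y \<and> x \<noteq> z \<and> y \<noteq> z"
    and "collinear_points {x, y, z}"
  then obtain l where l: "z = x + l *s (y - x)" by (auto simp: collinear_points_iff)
  have "z - x = l *s (y - x)" using l by simp
  moreover have "y - x \<in> A" "z - x \<in> A" using A add by (simp_all add: vec_char2(1)[OF two])
  moreover have "y - x \<noteq> 0" using ne by auto
  ultimately have "l = 0 \<or> l = 1"
    using \<open>scattered A\<close> unfolding scattered_def by blast
  then show False using l ne by auto
qed

text \<open>\<open>C\<close> is again additively closed and scattered, hence a cap. It is complete
  because every point has the form \<open>a + l *s b\<close> with \<open>a\<close>, \<open>b\<close>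
  in \<open>C\<close>, which lies on the line through \<open>a\<close> and
  \<open>a + b\<close>.\<close>

lemma complete_affine_cap_of_scattered:
  fixes A :: "('a::{field,finite} ^ 'n::finite) set"
  assumes two: "(1::'a) + 1 = 0" and add: "\<And>u v. u \<in> A \<Longrightarrow> v \<in> A \<Longrightarrow> u + v \<in> A"
    and zero: "0 \<in> A"
    and sc: "scattered A" and i: "\<And>v. v \<in> A \<Longrightarrow> v $ i = 0"
    and card: "card A * card A * CARD('a) = CARD('a) ^ CARD('n)"
    and l0: "l0 \<noteq> (0::'a)" "l0 \<noteq> 1"
  defines "C \<equiv> A \<union> (+) (axis i 1) ` A"
  shows "complete_affine_cap C" and "card C = 2 * card A"
proof -
  define e :: "'a ^ 'n" where "e = axis i 1"
  note char2 = vec_char2[OF two]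
  have e_i: "e $ i = 1" by (simp add: e_def)
  have C_iff: "v \<in> C \<longleftrightarrow> v \<in> A \<or> (\<exists>a\<in>A. v = e + a)" for v
    by (auto simp: C_def e_def)
  have ee: "e + (e + v) = v" for v
    using char2(2)[of e] by (simp flip: add.assoc)
  have C_iff2: "v \<in> C \<longleftrightarrow> v \<in> A \<or> e + v \<in> A" for v
    unfolding C_iff by (metis ee)
  have add_C: "u + v \<in> C" if "u \<in> C" "v \<in> C" for u v
    using that add[of u v] add[of u "e + v"] add[of "e + u" v] add[of "e + u" "e + v"]
    unfolding C_iff2 by (auto simp: add_ac ee)
  have "scattered C"
    unfolding scattered_def
  proof (intro ballI allI impI)
    fix u v l assume uv: "u \<in> C" "v \<in> C" and *: "u \<noteq> 0 \<and> v = l *s u"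
    have v_i: "v $ i = l * u $ i" using * by simp
    have C_i: "v \<in> A \<or> v $ i = 1" "u \<in> A \<or> u $ i = 1"
        "v $ i = 0 \<or> v $ i = 1"
      using uv by (auto simp: C_iff e_i i)
    show "l = 0 \<or> l = 1"
    proof (cases "u \<in> A")
      case True
      then have "v $ i = 0" using v_i i by simp
      then have "v \<in> A" using C_i(1) by simp
      then show ?thesis using True sc * unfolding scattered_def by blast
    next
      case False
      then show ?thesis using C_i v_i by auto
    qed
  qed
  then have cap: "affine_cap C"
    using two add_C by (intro affine_cap_if_scattered)
  have span: "\<exists>a\<in>A. \<exists>b\<in>A. \<exists>r. p = a + l *s b + r *s e" if l: "l \<noteq> 0" "l \<noteq> 1" for p l
  proof -
    \<comment> \<open>\<open>F\<close> is injective because \<open>A\<close> is scattered, and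
      \<open>card\<close> says that its domain has as many elements as the space.\<close>
    define F where "F = (\<lambda>(a, b, r). a + l *s b + r *s e)"
    have "inj_on F (A \<times> A \<times> UNIV)"
    proof (rule inj_onI)
      fix u v assume "u \<in> A \<times> A \<times> UNIV" "v \<in> A \<times> A \<times> UNIV" "F u = F v"
      then obtain a b r a' b' r' where uv: "u = (a, b, r)" "v = (a', b', r')"
        and A: "a \<in> A" "b \<in> A" "a' \<in> A" "b' \<in> A"
        and eq: "F (a, b, r) = F (a', b', r')"
        by (cases u, cases v) auto
      have "r = r'" using arg_cong[OF eq, of "\<lambda>v. v $ i"] A by (simp add: F_def i e_i)
      then have "a + l *s b = a' + l *s b'" using eq by (simp add: F_def)
      then have "a - a' = l *s (b' - b)"
        by (simp add: vector_ssub_ldistrib algebra_simps)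
      moreover have "a - a' \<in> A" "b' - b \<in> A" using A add by (simp_all add: char2(1))
      ultimately have "b' - b = 0"
        using sc l unfolding scattered_def by blast
      with \<open>a - a' = l *s (b' - b)\<close> show "u = v"
        using \<open>r = r'\<close> uv by simp
    qed
    then have "card (F ` (A \<times> A \<times> UNIV)) = CARD('a ^ 'n)"
      using card by (simp add: card_image card_cartesian_product mult.assoc)
    then have "F ` (A \<times> A \<times> UNIV) = UNIV"
      by (intro card_subset_eq) auto
    then have "p \<in> F ` (A \<times> A \<times> UNIV)" by simp
    then show ?thesis by (auto simp: F_def)
  qed
  have cover: "\<exists>a\<in>C. \<exists>b\<in>C. \<exists>l. p = a + l *s b" for p
  proof -
    \<comment> \<open>If \<open>r\<close> is 0 or 1, the multiple \<open>r *s e\<close> can be added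
      to \<open>a\<close> within \<open>C\<close>, and any scalar other than 0 and 1 serves.
      Otherwise \<open>r\<close> itself is the scalar, and \<open>e\<close> is added to
      \<open>b\<close>.\<close>
    define r where "r = p $ i"
    show ?thesis
    proof (cases "r = 0 \<or> r = 1")
      case True
      obtain a b r' where ab: "a \<in> A" "b \<in> A" "p = a + l0 *s b + r' *s e"
        using span[OF l0] by blast
      then have "r' = r" by (simp add: r_def i e_i)
      then have "p = (a + r *s e) + l0 *s b" using ab by (simp add: add_ac)
      moreover have "a + r *s e \<in> C" using True ab by (auto simp: C_iff add.commute)
      moreover have "b \<in> C" using ab by (simp add: C_iff)
      ultimately show ?thesis by blast
    next
      case False
      then obtain a b r' where ab: "a \<in> A" "b \<in> A" "p = a + r *s b + r' *s e"
        using span by blast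
      have "p $ i = r'" using arg_cong[OF ab(3), of "\<lambda>v. v $ i"] ab(1,2) by (simp add: i e_i)
      then have "r' = r" by (simp add: r_def)
      then have "p = a + r *s (e + b)" using ab by (simp add: vector_add_ldistrib add_ac)
      moreover have "a \<in> C" "e + b \<in> C" using ab by (auto simp: C_iff)
      ultimately show ?thesis by blast
    qed
  qed
  show "complete_affine_cap C"
    unfolding complete_affine_cap_def
  proof (intro conjI allI impI cap)
    fix D assume D: "affine_cap D \<and> C \<subseteq> D"
    have "p \<in> C" if "p \<in> D" for p
    proof (rule ccontr)
      assume "p \<notin> C"
      obtain a b l where ab: "a \<in> C" "b \<in> C" "p = a + l *s b" using cover by blast
      have "a + b \<in> C" using ab add_C by blast
      have "b \<noteq> 0" using ab \<open>p \<notin> C\<close> by auto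
      then have "a \<noteq> a + b" by simp
      moreover have "collinear_points {a, a + b, p}"
        using ab(3) calculation by (subst collinear_points_iff) auto
      moreover have "a \<noteq> p" "a + b \<noteq> p" using ab \<open>a + b \<in> C\<close> \<open>p \<notin> C\<close> by auto
      ultimately show False
        using D \<open>p \<in> D\<close> ab(1) \<open>a + b \<in> C\<close> unfolding affine_cap_def by blast
    qed
    then show "D = C" using D by blast
  qed
  have "e + a \<notin> A" if "a \<in> A" for a
    using i[OF that] i[of "e + a"] e_i by auto
  then have "A \<inter> (+) e ` A = {}" by auto
  then show "card C = 2 * card A"
    unfolding C_def e_def[symmetric] by (simp add: card_Un_disjoint card_image)
qed

section \<open>Coordinates of the product of blocks\<close>

text \<open>Coordinate 0 vanishes to keep the set in a hyperplane, 1 to 3 hold the three-dimensional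
  block, and each pair \<open>2 * j\<close>, \<open>2 * j + 1\<close> with \<open>j \<ge> 2\<close>
  holds a planar block \<open>(f j, f j ^ 2)\<close>. Natural-number indices allow any enumeration
  of the index type.\<close>

definition cap_coord :: "'a::field \<Rightarrow> 'a \<Rightarrow> 'a \<times> 'a \<times> 'a \<times> (nat \<Rightarrow> 'a) \<Rightarrow> nat \<Rightarrow> 'a"
  where "cap_coord c w = (\<lambda>(x, y, z, f) k.
    if k = 0 then 0
    else if k = 1 then c * z ^ 2 + x * w
    else if k = 2 then x ^ 2 + z ^ 2 + y * w
    else if k = 3 then y ^ 2 + z * w
    else if even k then f (k div 2) else f (k div 2) ^ 2)"

lemma cap_coord_simps:
  "cap_coord c w (x, y, z, f) 0 = 0"
  "cap_coord c w (x, y, z, f) 1 = c * z ^ 2 + x * w"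
  "cap_coord c w (x, y, z, f) 2 = x ^ 2 + z ^ 2 + y * w"
  "cap_coord c w (x, y, z, f) 3 = y ^ 2 + z * w"
  "j \<ge> 2 \<Longrightarrow> cap_coord c w (x, y, z, f) (2 * j) = f j"
  "j \<ge> 2 \<Longrightarrow> cap_coord c w (x, y, z, f) (2 * j + 1) = f j ^ 2"
  by (auto simp: cap_coord_def)

lemma less_2_mult_cases:
  fixes k m :: nat
  assumes "k < 2 * m"
  obtains "k = 0" | "k = 1" | "k = 2" | "k = 3"
    | j where "j \<in> {2..<m}" "k = 2 * j" | j where "j \<in> {2..<m}" "k = 2 * j + 1"
proof (cases "k < 4")
  case True
  then show ?thesis using that(1-4) by linarith
next
  case False
  then have "k div 2 \<in> {2..<m}" using assms by auto
  moreover have "k = 2 * (k div 2) \<or> k = 2 * (k div 2) + 1" by presburger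
  ultimately show ?thesis using that(5,6) by blast
qed

context char2_subfield
begin

lemma cap_coord_add:
  fixes c w :: 'a
  shows "cap_coord c w (x, y, z, f) k + cap_coord c w (x', y', z', f') k =
   cap_coord c w (x + x', y + y', z + z', \<lambda>j. f j + f' j) k"
  by (simp add: cap_coord_def square_add algebra_simps)

text \<open>One nonzero block suffices: either the three-dimensional one, or a planar one, where
  proportionality of both coordinates forces \<open>l ^ 2 = l\<close>.\<close>

lemma cap_coord_scattered:
  assumes c: "c \<in> K" "\<And>x. x \<in> K \<Longrightarrow> x ^ 7 + x \<noteq> c"
    and w: "w \<notin> K" and span: "\<And>y. \<exists>a\<in>K. \<exists>b\<in>K. y = a + b * w"
    and K: "x \<in> K" "y \<in> K" "z \<in> K" "x' \<in> K" "y' \<in> K" "z' \<in> K"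
    and nz: "k < 2 * m" "cap_coord c w (x, y, z, f) k \<noteq> 0"
    and eq: "\<And>k. k < 2 * m \<Longrightarrow> cap_coord c w (x', y', z', f') k = l * cap_coord c w (x, y, z, f) k"
    and "m \<ge> 2"
  shows "l = 0 \<or> l = 1"
proof (cases "x = 0 \<and> y = 0 \<and> z = 0")
  case False
  show ?thesis
    using eq[of 1] eq[of 2] eq[of 3] \<open>m \<ge> 2\<close> K False
    by (intro scattered_triple[OF c w span, of x y z x' y' z']) (auto simp: cap_coord_simps[simplified])
next
  case True
  have "\<exists>j\<in>{2..<m}. f j \<noteq> 0"
    using nz(1)
  proof (cases rule: less_2_mult_cases)
    case (5 j)
    then show ?thesis using nz(2) by (auto simp: cap_coord_simps)
  next
    case (6 j)
    then show ?thesis using nz(2) by (auto simp: cap_coord_simps(6)[simplified])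
  qed (use nz(2) True in \<open>auto simp: cap_coord_simps[simplified]\<close>)
  then obtain j where j: "j \<in> {2..<m}" "f j \<noteq> 0" by blast
  have "f' j = l * f j" using eq[of "2 * j"] j by (simp add: cap_coord_simps)
  moreover have "f' j ^ 2 = l * f j ^ 2"
    using eq[of "2 * j + 1"] j by (simp add: cap_coord_simps(6)[simplified])
  ultimately have "l ^ 2 * f j ^ 2 = l * f j ^ 2" by (simp add: power_mult_distrib)
  then show ?thesis using j(2) by (simp add: power2_eq_square)
qed

text \<open>The coefficients of \<open>w\<close> in coordinates 1 to 3 recover \<open>x\<close>,
  \<open>y\<close>, \<open>z\<close>, and the even coordinates recover \<open>f\<close>, which is
  extensional on \<open>{2..<m}\<close>.\<close>

lemma cap_coord_inj:
  assumes c: "c \<in> K" and w: "w \<notin> K"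
    and K: "x \<in> K" "y \<in> K" "z \<in> K" "x' \<in> K" "y' \<in> K" "z' \<in> K"
    and f: "f \<in> {2..<m} \<rightarrow>\<^sub>E UNIV" "f' \<in> {2..<m} \<rightarrow>\<^sub>E UNIV" and "m \<ge> 2"
    and eq: "\<And>k. k < 2 * m \<Longrightarrow> cap_coord c w (x, y, z, f) k = cap_coord c w (x', y', z', f') k"
  shows "(x, y, z, f) = (x', y', z', f')"
proof -
  have "c * z ^ 2 + x * w = c * z' ^ 2 + x' * w"
    "x ^ 2 + z ^ 2 + y * w = x' ^ 2 + z' ^ 2 + y' * w" "y ^ 2 + z * w = y' ^ 2 + z' * w"
    using eq[of 1] eq[of 2] eq[of 3] \<open>m \<ge> 2\<close> by (simp_all add: cap_coord_simps[simplified])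
  note this [THEN basis_unique[OF w, rotated -1]]
  then have "x = x'" "y = y'" "z = z'"
    using K c by (simp_all add: mem)
  moreover have "f = f'"
  proof (rule PiE_ext[OF f])
    fix j assume "j \<in> {2..<m}"
    then show "f j = f' j" using eq[of "2 * j"] by (simp add: cap_coord_simps)
  qed
  ultimately show ?thesis by simp
qed

end

section \<open>Construction of the cap and computation of its size\<close>

theorem theorem1p3:
  fixes q t n :: nat
  assumes "q = 2 ^ t" and "even t"
    and "n \<ge> 4" and "even n"
    and "CARD('a::{field,finite}) = q"
    and "CARD('n::finite) = n"
  shows "\<exists>C :: ('a ^ 'n) set.
           complete_affine_cap C \<and> real (card C) = 2 * sqrt (real q) ^ (n - 1)"
proof -
  obtain h where h: "t = 2 * h" using \<open>even t\<close> by blast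
  obtain m where m: "n = 2 * m" using \<open>even n\<close> by blast
  have "m \<ge> 2" using m \<open>n \<ge> 4\<close> by simp
  define s :: nat where "s = 2 ^ h"
  have card_a: "CARD('a) = 2 ^ (2 * h)" using assms h by simp
  have q: "q = s ^ 2" by (simp add: assms(1) h s_def power_mult mult.commute flip: power_mult)
  have "card {0, 1::'a} \<le> CARD('a)" by (rule card_mono) auto
  then have "h > 0" using card_a by (cases h) auto
  have two: "(1::'a) + 1 = 0" by (rule finite_field_char2[OF card_a])
  define K where "K = {x::'a. x ^ 2 ^ h = x}"
  have card_K: "card K = s" unfolding K_def s_def by (rule card_fixed[OF card_a \<open>h > 0\<close>])
  interpret char2_subfield K unfolding K_def by (rule char2_subfield_fixed[OF two])
  have "s \<ge> 2" using \<open>h > 0\<close> by (cases h) (auto simp: s_def)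
  have CARD: "CARD('a) = s * s" using assms q by (simp add: power2_eq_square)
  have "K \<noteq> UNIV" using card_K CARD \<open>s \<ge> 2\<close> by auto
  then obtain w where w: "w \<notin> K" by blast
  \<comment> \<open>Besides completing a basis over \<open>K\<close>, \<open>w\<close> serves as the
    auxiliary scalar \<open>l0\<close> in the completeness argument.\<close>
  have w01: "w \<noteq> 0" "w \<noteq> 1" using w zero_mem one_mem by auto
  obtain c where c: "c \<in> K" "\<And>x. x \<in> K \<Longrightarrow> x ^ 7 + x \<noteq> c" using ex_septic_nonvalue by blast
  have span: "\<exists>a\<in>K. \<exists>b\<in>K. y = a + b * w" for y
  proof -
    let ?F = "\<lambda>(a, b). a + b * w"
    have "inj_on ?F (K \<times> K)"
      using basis_unique[OF w] by (auto simp: inj_on_def)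
    then have "card (?F ` (K \<times> K)) = CARD('a)"
      by (simp add: card_image card_cartesian_product card_K CARD)
    then have "?F ` (K \<times> K) = UNIV" by (intro card_subset_eq) auto
    then have "y \<in> ?F ` (K \<times> K)" by simp
    then show ?thesis by auto
  qed

  obtain g where "bij_betw g (UNIV :: 'n set) {0..<CARD('n)}"
    using ex_bij_betw_finite_nat[of "UNIV :: 'n set"] by auto
  then have g: "bij_betw g (UNIV :: 'n set) {0..<2 * m}" using assms m by simp
  have g_less: "g i < 2 * m" for i using bij_betwE[OF g] by auto
  have g_surj: "\<exists>i. g i = k" if "k < 2 * m" for k
    using that bij_betw_imp_surj_on[OF g] by (metis UNIV_I atLeastLessThan_iff imageE le0)
  obtain i0 where i0: "g i0 = 0" using g_surj[of 0] \<open>m \<ge> 2\<close> by auto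

  define V :: "'a \<times> 'a \<times> 'a \<times> (nat \<Rightarrow> 'a) \<Rightarrow> 'a ^ 'n"
    where "V p = (\<chi> i. cap_coord c w p (g i))" for p
  define P where "P = K \<times> K \<times> K \<times> ({2..<m} \<rightarrow>\<^sub>E (UNIV :: 'a set))"
  define A where "A = V ` P"
  \<comment> \<open>Extensional functions make \<open>P\<close> easy to count, but their sums need
    not be extensional. Restriction is harmless since only indices below \<open>2 * m\<close>
    occur.\<close>
  have V_restrict: "V (x, y, z, f) = V (x, y, z, restrict f {2..<m})" for x y z f
    unfolding V_def vec_eq_iff
  proof
    fix i
    show "(\<chi> i. cap_coord c w (x, y, z, f) (g i)) $ i =
      (\<chi> i. cap_coord c w (x, y, z, restrict f {2..<m}) (g i)) $ i"
      using g_less[of i] by (auto simp: cap_coord_def)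
  qed
  have V_mem: "V (x, y, z, f) \<in> A" if "x \<in> K" "y \<in> K" "z \<in> K" for x y z f
    unfolding A_def V_restrict[of x y z f] using that by (intro imageI) (simp add: P_def)
  have A_cases: "\<exists>x\<in>K. \<exists>y\<in>K. \<exists>z\<in>K. \<exists>f. v = V (x, y, z, f)" if "v \<in> A" for v
    using that by (auto simp: A_def P_def)
  have add_A: "u + v \<in> A" if "u \<in> A" "v \<in> A" for u v
  proof -
    obtain x y z f where u: "x \<in> K" "y \<in> K" "z \<in> K" "u = V (x, y, z, f)"
      using A_cases[OF \<open>u \<in> A\<close>] by blast
    obtain x' y' z' f' where v: "x' \<in> K" "y' \<in> K" "z' \<in> K" "v = V (x', y', z', f')"
      using A_cases[OF \<open>v \<in> A\<close>] by blast
    have "u + v = V (x + x', y + y', z + z', \<lambda>j. f j + f' j)"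
      by (simp add: u v V_def vec_eq_iff cap_coord_add)
    then show ?thesis using u v by (simp add: V_mem add_mem)
  qed
  have "V (0, 0, 0, \<lambda>_. 0) = 0" by (simp add: V_def vec_eq_iff cap_coord_def)
  then have zero_A: "0 \<in> A" using V_mem[of 0 0 0] zero_mem by metis
  have i0_A: "v $ i0 = 0" if "v \<in> A" for v
    using A_cases[OF that] by (auto simp: V_def i0 cap_coord_simps)
  have "scattered A"
    unfolding scattered_def
  proof (intro ballI allI impI)
    fix u v l assume uv: "u \<in> A" "v \<in> A" and *: "u \<noteq> 0 \<and> v = l *s u"
    obtain x y z f where u: "x \<in> K" "y \<in> K" "z \<in> K" "u = V (x, y, z, f)"
      using A_cases[OF \<open>u \<in> A\<close>] by blast
    obtain x' y' z' f' where v: "x' \<in> K" "y' \<in> K" "z' \<in> K" "v = V (x', y', z', f')"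
      using A_cases[OF \<open>v \<in> A\<close>] by blast
    obtain i where "cap_coord c w (x, y, z, f) (g i) \<noteq> 0"
      using * by (auto simp: u V_def vec_eq_iff)
    moreover have "cap_coord c w (x', y', z', f') k = l * cap_coord c w (x, y, z, f) k"
      if k: "k < 2 * m" for k
    proof -
      obtain j where "g j = k" using g_surj[OF k] by blast
      have "V (x', y', z', f') $ j = l * V (x, y, z, f) $ j" using * u v by simp
      then show ?thesis by (simp add: V_def \<open>g j = k\<close>)
    qed
    ultimately show "l = 0 \<or> l = 1"
      using cap_coord_scattered[OF c w span u(1-3) v(1-3) g_less] \<open>m \<ge> 2\<close> by blast
  qed
  moreover have card_A: "card A = s ^ (n - 1)"
  proof -
    have "inj_on V P"
    proof (rule inj_onI)
      fix p p' assume "p \<in> P" "p' \<in> P" and eq: "V p = V p'"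
      then obtain x y z f x' y' z' f' where p: "p = (x, y, z, f)" "p' = (x', y', z', f')"
        and K: "x \<in> K" "y \<in> K" "z \<in> K" "x' \<in> K" "y' \<in> K" "z' \<in> K"
        and f: "f \<in> {2..<m} \<rightarrow>\<^sub>E UNIV" "f' \<in> {2..<m} \<rightarrow>\<^sub>E UNIV"
        unfolding P_def by (cases p; cases p') auto
      have coord_eq: "cap_coord c w p k = cap_coord c w p' k" if k: "k < 2 * m" for k
      proof -
        obtain j where "g j = k" using g_surj[OF k] by blast
        then show ?thesis using arg_cong[OF eq, of "\<lambda>v. v $ j"] by (simp add: V_def)
      qed
      show "p = p'"
        unfolding p by (rule cap_coord_inj[OF c(1) w K f \<open>m \<ge> 2\<close>]) (use coord_eq p in simp)
    qed
    then have "card A = card P" unfolding A_def by (rule card_image)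
    \<comment> \<open>The three parameters in \<open>K\<close> contribute \<open>s ^ 3\<close>, and
      each of the \<open>m - 2\<close> planar blocks contributes \<open>s * s\<close>.\<close>
    also have "\<dots> = s * (s * (s * (s * s) ^ (m - 2)))"
      by (simp add: P_def card_cartesian_product card_K card_PiE CARD)
    also have "\<dots> = s ^ (3 + 2 * (m - 2))"
      by (simp add: power_add power_mult power_mult_distrib power2_eq_square eval_nat_numeral)
    also have "3 + 2 * (m - 2) = n - 1" using m \<open>m \<ge> 2\<close> by simp
    finally show ?thesis .
  qed
  moreover have "card A * card A * CARD('a) = CARD('a) ^ CARD('n)"
  proof -
    have "card A * card A * CARD('a) = (s * s ^ (n - 1)) * (s * s ^ (n - 1))"
      by (simp add: card_A CARD mult_ac)
    also have "s * s ^ (n - 1) = s ^ n" using \<open>n \<ge> 4\<close> by (simp flip: power_Suc)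
    finally show ?thesis unfolding assms(6) by (simp add: CARD power_mult_distrib)
  qed
  ultimately have "complete_affine_cap (A \<union> (+) (axis i0 1) ` A)"
    "card (A \<union> (+) (axis i0 1) ` A) = 2 * s ^ (n - 1)"
    using complete_affine_cap_of_scattered[OF two add_A zero_A _ i0_A _ w01] by auto
  moreover have "sqrt (real q) = real s" by (simp add: q)
  ultimately show ?thesis by (metis of_nat_mult of_nat_numeral of_nat_power)
qed

end
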